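(* Let $G$ be a finitely presented group and let $H\unlhd G$ be a finitely generated normal subgroup. If $G$ splits over $H$, then $H$ is invariantly finitely $L$-presented.
   Context: $G$ splits over the normal subgroup $H$ if there is a subgroup $S\le G$ with $G=HS$ and $S\cap H=\{1\}$, i.e. $G\cong H\rtimes S$. Endomorphisms act on the right, written $g\mapsto g^\sigma$. For an alphabet $\mathcal X$, $F(\mathcal X)$ is the free group over $\mathcal X$; $\langle A\rangle^F$ is the normal closure of $A$ in $F$. An $L$-presentation $\langle\mathcal X\mid\mathcal Q\mid\Phi\mid\mathcal R\rangle$ consists of an alphabet $\mathcal X$ (generators), subsets $\mathcal Q$ (fixed relations) and $\mathcal R$ (iterated relations) of $F=F(\mathcal X)$, and a subset $\Phi\subseteq\mathrm{End}(F)$ (substitutions). With $\Phi^*\subseteq\mathrm{End}(F)$ the monoid generated by $\Phi$, it defines the group $F/K$ where $K=\langle\mathcal Q\cup\bigcup_{\sigma\in\Phi^*}\mathcal R^\sigma\rangle^F$. It is finite if $\mathcal X,\mathcal Q,\Phi,\mathcal R$ are finite. It is invariant if each $\varphi\in\Phi$ induces an endomorphism of the group, i.e. $K^\varphi\subseteq K$. A group is invariantly finitely $L$-presented if it is isomorphic to the group defined by some invariant finite $L$-presentation. *)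

theory Defs
  imports "HOL-Algebra.Generated_Groups"
begin

section \<open>Free groups\<close>

text \<open>
  A letter \<open>(x, True)\<close> stands for the generator \<open>x\<close> and \<open>(x, False)\<close> for its formal inverse.
  The free group over \<open>X\<close> consists of the freely reduced words in these letters. Multiplication
  is concatenation followed by free reduction: the letters of the left factor are prepended one
  after the other, from right to left, to the reduced right factor.
\<close>

type_synonym 'a letter = "'a \<times> bool"
type_synonym 'a word = "'a letter list"

definition inv_letter :: "'a letter \<Rightarrow> 'a letter" where
  "inv_letter l = (fst l, \<not> snd l)"

definition reduced :: "'a word \<Rightarrow> bool" where
  "reduced w \<longleftrightarrow> (\<forall>i. Suc i < length w \<longrightarrow> w ! Suc i \<noteq> inv_letter (w ! i))"

fun prepend :: "'a letter \<Rightarrow> 'a word \<Rightarrow> 'a word" where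
  "prepend l [] = [l]"
| "prepend l (m # w) = (if m = inv_letter l then w else l # m # w)"

definition free_group :: "'a set \<Rightarrow> 'a word monoid" where
  "free_group X =
     \<lparr>carrier = {w. reduced w \<and> set w \<subseteq> X \<times> UNIV},
      mult = (\<lambda>u v. foldr prepend u v),
      one = []\<rparr>"

lemma inv_letter_simps [simp]:
  "inv_letter (inv_letter l) = l" "inv_letter l \<noteq> l" "l \<noteq> inv_letter l"
  "fst (inv_letter l) = fst l" "(inv_letter l = inv_letter m) = (l = m)"
  by (auto simp: inv_letter_def prod_eq_iff)

lemma reduced_Nil [simp]: "reduced []"
  by (simp add: reduced_def)

lemma reduced_single [simp]: "reduced [l]"
  by (simp add: reduced_def)

lemma reduced_Cons_Cons [simp]:
  "reduced (l # m # w) \<longleftrightarrow> m \<noteq> inv_letter l \<and> reduced (m # w)"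
proof
  assume r: "reduced (l # m # w)"
  have "(m # w) ! Suc i \<noteq> inv_letter ((m # w) ! i)" if "Suc i < length (m # w)" for i
    using r[unfolded reduced_def, rule_format, of "Suc i"] that by simp
  then show "m \<noteq> inv_letter l \<and> reduced (m # w)"
    using r[unfolded reduced_def, rule_format, of 0] by (simp add: reduced_def)
next
  assume r: "m \<noteq> inv_letter l \<and> reduced (m # w)"
  show "reduced (l # m # w)"
    unfolding reduced_def
  proof (intro allI impI)
    fix i assume "Suc i < length (l # m # w)"
    then show "(l # m # w) ! Suc i \<noteq> inv_letter ((l # m # w) ! i)"
      using r by (cases i) (auto simp: reduced_def)
  qed
qed

lemma reduced_ConsD: "reduced (l # w) \<Longrightarrow> reduced w"
  by (cases w) auto

lemma reduced_prepend: "reduced w \<Longrightarrow> reduced (prepend l w)"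
  by (cases w) (auto dest: reduced_ConsD)

lemma prepend_inv: "reduced w \<Longrightarrow> prepend (inv_letter l) (prepend l w) = w"
  by (cases w rule: remdups_adj.cases) auto

lemma prepend_inv': "reduced w \<Longrightarrow> prepend l (prepend (inv_letter l) w) = w"
  using prepend_inv[of w "inv_letter l"] by simp

lemma prepend_reduced: "reduced (l # w) \<Longrightarrow> prepend l w = l # w"
  by (cases w) auto

lemma reduced_foldr: "reduced v \<Longrightarrow> reduced (foldr prepend u v)"
  by (induction u) (auto intro: reduced_prepend)

lemma set_foldr_prepend: "set (foldr prepend u v) \<subseteq> set u \<union> set v"
proof (induction u)
  case (Cons l u)
  have "set (prepend l w) \<subseteq> insert l (set w)" for w
    by (cases w) auto
  with Cons show ?case by fastforce
qed simp

lemma foldr_prepend_Nil: "reduced w \<Longrightarrow> foldr prepend w [] = w"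
proof (induction w)
  case (Cons l w)
  then have "foldr prepend w [] = w" by (blast dest: reduced_ConsD)
  then show ?case using Cons.prems by (simp add: prepend_reduced)
qed simp

lemma foldr_prepend_prepend:
  "reduced w \<Longrightarrow> foldr prepend (prepend l v) w = prepend l (foldr prepend v w)"
  by (cases v) (auto simp: prepend_inv' reduced_foldr)

lemma foldr_prepend_assoc:
  "reduced w \<Longrightarrow> foldr prepend (foldr prepend u v) w = foldr prepend u (foldr prepend v w)"
  by (induction u) (auto simp: foldr_prepend_prepend)

lemma foldr_prepend_left_inverse:
  "reduced w \<Longrightarrow> foldr prepend (rev (map inv_letter u)) (foldr prepend u w) = w"
  by (induction u) (auto simp: prepend_inv reduced_foldr)

lemma group_free_group: "group (free_group X)"
proof (rule groupI)
  fix u v w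
  assume u: "u \<in> carrier (free_group X)" and v: "v \<in> carrier (free_group X)"
    and w: "w \<in> carrier (free_group X)"
  show "u \<otimes>\<^bsub>free_group X\<^esub> v \<in> carrier (free_group X)"
    using u v set_foldr_prepend[of u v] by (auto simp: free_group_def reduced_foldr)
  show "u \<otimes>\<^bsub>free_group X\<^esub> v \<otimes>\<^bsub>free_group X\<^esub> w =
        u \<otimes>\<^bsub>free_group X\<^esub> (v \<otimes>\<^bsub>free_group X\<^esub> w)"
    using w by (simp add: free_group_def foldr_prepend_assoc)
next
  fix u assume u: "u \<in> carrier (free_group X)"
  let ?v = "foldr prepend (rev (map inv_letter u)) []"
  have "?v \<in> carrier (free_group X)"
    using u set_foldr_prepend[of "rev (map inv_letter u)" "[]"]
    by (fastforce simp: free_group_def reduced_foldr inv_letter_def)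
  moreover have "foldr prepend ?v u = []"
    using u foldr_prepend_left_inverse[of "[]" u]
    by (simp add: free_group_def foldr_prepend_assoc foldr_prepend_Nil)
  ultimately show "\<exists>v\<in>carrier (free_group X). v \<otimes>\<^bsub>free_group X\<^esub> u = \<one>\<^bsub>free_group X\<^esub>"
    by (auto simp: free_group_def)
qed (auto simp: free_group_def)

lemma free_group_gen: "x \<in> X \<Longrightarrow> [(x, b)] \<in> carrier (free_group X)"
  by (simp add: free_group_def)

lemma inv_free_group_gen:
  assumes "x \<in> X"
  shows "inv\<^bsub>free_group X\<^esub> [(x, True)] = [(x, False)]"
proof -
  interpret group "free_group X" by (rule group_free_group)
  show ?thesis
    by (rule inv_equality) (use assms in \<open>auto simp: free_group_def inv_letter_def\<close>)
qed

theorem free_group_universal: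
  assumes "group G" and f: "f \<in> X \<rightarrow> carrier G"
  shows "\<exists>h \<in> hom (free_group X) G. (\<forall>x\<in>X. h [(x, True)] = f x) \<and>
           (\<forall>k \<in> hom (free_group X) G. (\<forall>x\<in>X. k [(x, True)] = f x) \<longrightarrow>
              (\<forall>w \<in> carrier (free_group X). k w = h w))"
proof -
  interpret G: group G by fact
  interpret F: group "free_group X" by (rule group_free_group)
  define e where "e l = (if snd l then f (fst l) else inv\<^bsub>G\<^esub> (f (fst l)))" for l
  define h where "h w = foldr (\<lambda>l y. e l \<otimes>\<^bsub>G\<^esub> y) w \<one>\<^bsub>G\<^esub>" for w
  have e: "e l \<in> carrier G" if "l \<in> X \<times> UNIV" for l
    using that f by (auto simp: e_def)
  have h_Cons: "h (l # w) = e l \<otimes>\<^bsub>G\<^esub> h w" for l w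
    by (simp add: h_def)
  have h: "h w \<in> carrier G" if "set w \<subseteq> X \<times> UNIV" for w
    using that e by (induction w) (auto simp: h_def)
  have h_prepend: "h (prepend l w) = e l \<otimes>\<^bsub>G\<^esub> h w"
    if "l \<in> X \<times> UNIV" "set w \<subseteq> X \<times> UNIV" for l w
  proof (cases "\<exists>v. w = inv_letter l # v")
    case True
    then obtain v where v: "w = inv_letter l # v" by blast
    have "e l \<otimes>\<^bsub>G\<^esub> e (inv_letter l) = \<one>\<^bsub>G\<^esub>"
      using that f by (auto simp: e_def inv_letter_def Pi_iff)
    moreover have "inv_letter l \<in> X \<times> UNIV" "set v \<subseteq> X \<times> UNIV"
      using that v by auto
    ultimately have "e l \<otimes>\<^bsub>G\<^esub> (e (inv_letter l) \<otimes>\<^bsub>G\<^esub> h v) = h v"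
      using that e h by (simp flip: G.m_assoc)
    then show ?thesis by (simp add: v h_Cons)
  next
    case False
    then have "prepend l w = l # w" by (cases w) auto
    then show ?thesis by (simp add: h_Cons)
  qed
  have h_mult: "h (foldr prepend u v) = h u \<otimes>\<^bsub>G\<^esub> h v"
    if "set u \<subseteq> X \<times> UNIV" "set v \<subseteq> X \<times> UNIV" for u v
    using that
  proof (induction u)
    case Nil
    then show ?case by (simp add: h_def h[unfolded h_def])
  next
    case (Cons l u)
    then have "set (foldr prepend u v) \<subseteq> X \<times> UNIV"
      using set_foldr_prepend[of u v] by auto
    with Cons show ?case
      by (simp add: h_prepend h_Cons G.m_assoc e h)
  qed
  have hom: "h \<in> hom (free_group X) G"
    by (rule homI) (auto simp: free_group_def h h_mult)
  moreover have "\<forall>x\<in>X. h [(x, True)] = f x"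
    using f by (auto simp: h_def e_def Pi_iff)
  moreover have "k w = h w"
    if k: "k \<in> hom (free_group X) G" and kf: "\<forall>x\<in>X. k [(x, True)] = f x"
      and w: "w \<in> carrier (free_group X)" for k w
  proof -
    interpret K: group_hom "free_group X" G k
      using k by unfold_locales
    have k1: "k [l] = e l" if lX: "l \<in> X \<times> UNIV" for l
    proof (cases "snd l")
      case True
      then show ?thesis using lX kf by (auto simp: e_def)
    next
      case False
      then obtain x where l: "l = (x, False)" and x: "x \<in> X"
        using lX by (cases l) auto
      then show ?thesis
        using kf K.hom_inv[OF free_group_gen[OF x, of True]]
        by (simp add: e_def inv_free_group_gen)
    qed
    from w show ?thesis
    proof (induction w)
      case Nil
      then show ?case using K.hom_one by (simp add: h_def free_group_def)
    next
      case (Cons l w)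
      then have l: "l \<in> X \<times> UNIV" "[l] \<in> carrier (free_group X)"
        and w: "w \<in> carrier (free_group X)" and r: "reduced (l # w)"
        by (auto simp: free_group_def dest: reduced_ConsD)
      have "l # w = [l] \<otimes>\<^bsub>free_group X\<^esub> w"
        using r by (simp add: free_group_def prepend_reduced)
      then have "k (l # w) = k [l] \<otimes>\<^bsub>G\<^esub> k w"
        using l w by simp
      then show ?case using Cons.IH[OF w] l by (simp add: k1 h_Cons)
    qed
  qed
  ultimately show ?thesis by blast
qed


section \<open>Normal closures, finite generation, finite presentation, splitting\<close>

definition normal_closure :: "('g, 'b) monoid_scheme \<Rightarrow> 'g set \<Rightarrow> 'g set" where
  "normal_closure G A = \<Inter>{N. N \<lhd> G \<and> A \<subseteq> N}"

lemma normal_closure_normal: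
  assumes "group G" "A \<subseteq> carrier G"
  shows "normal_closure G A \<lhd> G"
proof -
  interpret group G by fact
  let ?S = "{N. N \<lhd> G \<and> A \<subseteq> N}"
  have ne: "carrier G \<in> ?S"
    using assms normal_inv_iff subgroup_self by auto
  have "subgroup (\<Inter>?S) G"
    by (rule subgroups_Inter) (use ne in \<open>auto simp: normal_inv_iff\<close>)
  moreover have "\<forall>x\<in>carrier G. \<forall>h\<in>\<Inter>?S. x \<otimes>\<^bsub>G\<^esub> h \<otimes>\<^bsub>G\<^esub> inv\<^bsub>G\<^esub> x \<in> \<Inter>?S"
    by (auto simp: normal_inv_iff)
  ultimately show ?thesis
    by (simp add: normal_inv_iff normal_closure_def)
qed

definition finitely_generated :: "('g, 'b) monoid_scheme \<Rightarrow> bool" where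
  "finitely_generated G \<longleftrightarrow> (\<exists>A. finite A \<and> A \<subseteq> carrier G \<and> generate G A = carrier G)"

text \<open>
  Only the cardinality of an alphabet matters up to isomorphism, so in the existential
  quantifiers over finite presentations (here and below) it is no restriction to take the
  generators from \<^typ>\<open>nat\<close>.
\<close>

definition finitely_presented :: "('g, 'b) monoid_scheme \<Rightarrow> bool" where
  "finitely_presented G \<longleftrightarrow>
     (\<exists>(X :: nat set) R. finite X \<and> finite R \<and> R \<subseteq> carrier (free_group X) \<and>
        G \<cong> free_group X Mod normal_closure (free_group X) R)"

definition splits_over :: "('g, 'b) monoid_scheme \<Rightarrow> 'g set \<Rightarrow> bool" where
  "splits_over G H \<longleftrightarrow>
     (\<exists>S. subgroup S G \<and> carrier G = H <#>\<^bsub>G\<^esub> S \<and> S \<inter> H = {\<one>\<^bsub>G\<^esub>})"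


section \<open>L-presentations\<close>

text \<open>
  Substitutions are elements of \<^term>\<open>hom F F\<close>; their values outside the carrier of \<open>F\<close> are
  irrelevant to everything below.
\<close>

record 'a l_presentation =
  gens :: "'a set"
  fixed_rels :: "'a word set"
  substs :: "('a word \<Rightarrow> 'a word) set"
  iterated_rels :: "'a word set"

definition l_presentation :: "'a l_presentation \<Rightarrow> bool" where
  "l_presentation P \<longleftrightarrow>
     (let F = free_group (gens P) in
        fixed_rels P \<subseteq> carrier F \<and> substs P \<subseteq> hom F F \<and> iterated_rels P \<subseteq> carrier F)"

inductive_set generated_monoid :: "('c \<Rightarrow> 'c) set \<Rightarrow> ('c \<Rightarrow> 'c) set" for \<Phi> where
  one: "id \<in> generated_monoid \<Phi>"
| incl: "\<phi> \<in> \<Phi> \<Longrightarrow> \<phi> \<in> generated_monoid \<Phi>"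
| mult: "\<sigma> \<in> generated_monoid \<Phi> \<Longrightarrow> \<tau> \<in> generated_monoid \<Phi> \<Longrightarrow> \<tau> \<circ> \<sigma> \<in> generated_monoid \<Phi>"

definition l_kernel :: "'a l_presentation \<Rightarrow> 'a word set" where
  "l_kernel P = normal_closure (free_group (gens P))
     (fixed_rels P \<union> (\<Union>\<sigma>\<in>generated_monoid (substs P). \<sigma> ` iterated_rels P))"

definition l_group :: "'a l_presentation \<Rightarrow> 'a word set monoid" where
  "l_group P = free_group (gens P) Mod l_kernel P"

definition finite_l_presentation :: "'a l_presentation \<Rightarrow> bool" where
  "finite_l_presentation P \<longleftrightarrow>
     l_presentation P \<and> finite (gens P) \<and> finite (fixed_rels P) \<and>
     finite (substs P) \<and> finite (iterated_rels P)"

definition invariant_l_presentation :: "'a l_presentation \<Rightarrow> bool" where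
  "invariant_l_presentation P \<longleftrightarrow>
     l_presentation P \<and> (\<forall>\<phi>\<in>substs P. \<phi> ` l_kernel P \<subseteq> l_kernel P)"

definition invariantly_finitely_L_presented :: "('g, 'b) monoid_scheme \<Rightarrow> bool" where
  "invariantly_finitely_L_presented G \<longleftrightarrow>
     (\<exists>P :: nat l_presentation.
        finite_l_presentation P \<and> invariant_l_presentation P \<and> G \<cong> l_group P)"

lemma generated_monoid_hom:
  assumes "\<Phi> \<subseteq> hom F F" "\<sigma> \<in> generated_monoid \<Phi>"
  shows "\<sigma> \<in> hom F F"
  using assms(2)
proof induction
  case one
  then show ?case by (simp add: hom_def)
next
  case (incl \<phi>)
  then show ?case using assms(1) by blast
next
  case (mult \<sigma> \<tau>)
  then show ?case by (blast intro: Group.hom_compose)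
qed

lemma l_kernel_normal:
  assumes "l_presentation P"
  shows "l_kernel P \<lhd> free_group (gens P)"
proof -
  have "\<sigma> w \<in> carrier (free_group (gens P))"
    if "\<sigma> \<in> generated_monoid (substs P)" "w \<in> iterated_rels P" for \<sigma> w
    using generated_monoid_hom[OF _ that(1), of "free_group (gens P)"] that(2) assms
    by (auto simp: l_presentation_def Let_def hom_def)
  then show ?thesis
    using assms unfolding l_kernel_def
    by (intro normal_closure_normal group_free_group) (auto simp: l_presentation_def Let_def)
qed

lemma group_l_group: "l_presentation P \<Longrightarrow> group (l_group P)"
  by (simp add: l_group_def l_kernel_normal normal.factorgroup_is_group)

end

theory Submission
  imports Defs
begin

text \<open>
  Write \<open>G = H \<rtimes> S\<close>, let \<open>\<tau>\<close> be the retraction of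
  \<open>G\<close> onto \<open>S\<close> with kernel \<open>H\<close>, let \<open>p : F(X)
  \<rightarrow> G\<close> be the projection of a finite presentation \<open>\<langle>X |
  R\<rangle>\<close> of \<open>G\<close>, and let \<open>\<pi> : F(Z) \<rightarrow> H\<close> be
  onto with \<open>Z\<close> finite. The group \<open>G\<close> acts on the set \<open>H\<close> by
  \<open>g \<cdot> h = g h \<tau>(g)\<inverse>\<close>: here \<open>S\<close> acts by conjugation
  and \<open>H\<close> by left translation, and \<open>g\<close> moves \<open>h\<close> to \<open>(g
  \<tau>(g)\<inverse>) (\<tau>(g) h \<tau>(g)\<inverse>)\<close>, an affine map. For each letter
  \<open>l\<close> of \<open>X\<close> this map lifts to \<open>F(Z)\<close> as \<open>A\<^sub>l(v)
  = a\<^sub>l \<sigma>\<^sub>l(v)\<close>, where the word \<open>a\<^sub>l\<close> lifts \<open>p(l)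
  \<tau>(p(l))\<inverse>\<close> and the endomorphism \<open>\<sigma>\<^sub>l\<close> lifts
  conjugation by \<open>\<tau>(p(l))\<close>. For a word \<open>w = l\<^sub>1 \<dots>
  l\<^sub>n\<close> put \<open>A\<^sub>w = A\<^bsub>l\<^sub>1\<^esub> \<circ> \<dots> \<circ>
  A\<^bsub>l\<^sub>n\<^esub>\<close>, and similarly \<open>\<sigma>\<^sub>w\<close>; then
  \<open>A\<^sub>w(v) = A\<^sub>w(1) \<sigma>\<^sub>w(v)\<close>.

  The lifted maps need not define an action of \<open>G\<close> on \<open>F(Z)\<close>, but they do
  so modulo finitely many relators and their images under products of the \<open>\<sigma>\<^sub>l\<close>.
  Choose a word \<open>w\<^sub>z\<close> in \<open>F(X)\<close> over the image of each letter
  \<open>z\<close> of \<open>Z\<close>. The \<open>L\<close>-presentation has generators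
  \<open>Z\<close>, no fixed relations, the substitutions \<open>\<sigma>\<^sub>l\<close>, and
  iterated relations saying that \<open>A\<^sub>w\<close> is left translation by \<open>u\<close>,
  namely \<open>A\<^sub>w(1) u\<inverse>\<close> and \<open>\<sigma>\<^sub>w(z) z\<inverse>\<close>
  for \<open>z \<in> Z\<close>, where \<open>(w, u)\<close> ranges over \<open>(l l\<inverse>,
  1)\<close> for the letters \<open>l\<close> of \<open>X\<close>, \<open>(r, 1)\<close> for
  \<open>r \<in> R\<close>, and \<open>(w\<^sub>z, z)\<close> for the letters \<open>z\<close> of
  \<open>Z\<close>. Without fixed relations the kernel \<open>K\<close> is automatically mapped into
  itself by the substitutions, so invariance comes for free.

  It remains to see that \<open>K = ker \<pi>\<close>. The relations hold in \<open>H\<close> and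
  \<open>ker \<pi>\<close> is stable under the \<open>\<sigma>\<^sub>l\<close>, whence \<open>K
  \<subseteq> ker \<pi>\<close> (\<open>l_kernel_subset\<close>). Conversely
  (\<open>kernel_subset\<close>), the maps \<open>A\<^sub>l\<close> induce an action of
  \<open>F(X)\<close> on \<open>F(Z)/K\<close>, in which the normal closure of \<open>R\<close> acts
  trivially (\<open>normal_closure_acts_trivially\<close>) and \<open>w\<^sub>z\<close> acts as left
  translation by \<open>z\<close>. If \<open>\<pi>(v) = 1\<close>, then replacing every letter
  \<open>z\<close> of \<open>v\<close> by \<open>w\<^sub>z\<close> gives a word in \<open>ker
  p\<close>, the normal closure of \<open>R\<close>; it acts both trivially and as left translation
  by \<open>v\<close>, so \<open>v \<in> K\<close>.
\<close>

section \<open>Free groups and cosets\<close>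

lemma free_group_letters:
  "w \<in> carrier (free_group X) \<Longrightarrow> set w \<subseteq> X \<times> UNIV"
  by (simp add: free_group_def)

lemma free_group_letter: "l \<in> X \<times> UNIV \<Longrightarrow> [l] \<in> carrier (free_group X)"
  by (auto simp: free_group_def)

lemma free_group_one: "\<one>\<^bsub>free_group X\<^esub> = []"
  by (simp add: free_group_def)

lemma free_group_Nil [simp]:
  "[] \<in> carrier (free_group X)"
  "[] \<otimes>\<^bsub>free_group X\<^esub> w = w"
  "w \<in> carrier (free_group X) \<Longrightarrow> w \<otimes>\<^bsub>free_group X\<^esub> [] = w"
  "inv\<^bsub>free_group X\<^esub> [] = []"
  using group.is_monoid[OF group_free_group, THEN monoid.inv_one, of X]
  by (auto simp: free_group_def foldr_prepend_Nil)

text \<open>The identity of the free group is written as the empty word throughout, so that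
  \<open>foldr\<close> computes on it; this replaces the general rule on images of the identity.\<close>

lemma hom_free_group_Nil:
  "group G \<Longrightarrow> h \<in> hom (free_group X) G \<Longrightarrow> h [] = \<one>\<^bsub>G\<^esub>"
  using hom_one[OF _ group_free_group] by (metis free_group_one)

lemma free_group_ConsD:
  assumes "l # w \<in> carrier (free_group X)"
  shows "l \<in> X \<times> UNIV" "w \<in> carrier (free_group X)"
    "l # w = [l] \<otimes>\<^bsub>free_group X\<^esub> w"
  using assms by (auto simp: free_group_def prepend_reduced dest: reduced_ConsD)

lemma free_group_hom_eqI:
  assumes "group G" "h \<in> hom (free_group X) G" "k \<in> hom (free_group X) G"
    and "\<And>x. x \<in> X \<Longrightarrow> h [(x, True)] = k [(x, True)]"
    and "w \<in> carrier (free_group X)"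
  shows "h w = k w"
proof -
  have "(\<lambda>x. h [(x, True)]) \<in> X \<rightarrow> carrier G"
    using assms(2) free_group_gen by (fastforce simp: hom_def)
  from free_group_universal[OF assms(1) this] obtain g where
    g: "\<forall>k \<in> hom (free_group X) G. (\<forall>x\<in>X. k [(x, True)] = h [(x, True)]) \<longrightarrow>
              (\<forall>w \<in> carrier (free_group X). k w = g w)"
    by blast
  have "h w = g w"
    using assms(5) by (intro g[rule_format, OF assms(2)]) simp_all
  moreover have "k w = g w"
    using assms(4,5) by (intro g[rule_format, OF assms(3)]) simp_all
  ultimately show ?thesis by simp
qed

lemma (in normal) rcos_eqI:
  assumes "x \<in> carrier G" "y \<in> carrier G" "x \<otimes> inv y \<in> H"
  shows "H #> x = H #> y"
proof -
  have "x = (x \<otimes> inv y) \<otimes> y"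
    using assms(1,2) by (simp add: m_assoc)
  then have "x \<in> H #> y"
    using assms(3) unfolding r_coset_def by blast
  then show ?thesis
    using repr_independence assms(2) is_subgroup by simp
qed

text \<open>This lets substitutions act on the cosets of the kernel of an \<open>L\<close>-presentation.\<close>

lemma (in normal) hom_preserves_rcos_eq:
  assumes "\<phi> \<in> hom G G" "\<phi> ` H \<subseteq> H"
    and "x \<in> carrier G" "y \<in> carrier G" "H #> x = H #> y"
  shows "H #> \<phi> x = H #> \<phi> y"
proof -
  interpret \<phi>: group_hom G G \<phi>
    using assms(1) by unfold_locales
  have "x \<in> H #> y"
    using assms(3,5) rcos_self is_subgroup by metis
  then obtain h where h: "h \<in> H" "x = h \<otimes> y"
    unfolding r_coset_def by blast
  have "\<phi> x \<otimes> inv \<phi> y = \<phi> h"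
    using h assms(4) by (simp add: m_assoc)
  then have "\<phi> x \<otimes> inv \<phi> y \<in> H"
    using h assms(2) by auto
  then show ?thesis
    using assms(3,4) by (intro rcos_eqI) auto
qed

lemma (in group) normal_vimage:
  assumes "\<phi> \<in> hom G G" "N \<lhd> G"
  shows "{x \<in> carrier G. \<phi> x \<in> N} \<lhd> G"
proof -
  interpret \<phi>: group_hom G G \<phi>
    using assms(1) by unfold_locales
  interpret N: normal N G by fact
  have "subgroup {x \<in> carrier G. \<phi> x \<in> N} G"
    by (rule subgroupI) (auto intro: exI[of _ \<one>])
  moreover have "\<phi> (x \<otimes> h \<otimes> inv x) \<in> N" if "x \<in> carrier G" "h \<in> carrier G" "\<phi> h \<in> N" for x h
    using that N.inv_op_closed2 by simp
  ultimately show ?thesis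
    by (simp add: normal_inv_iff)
qed

section \<open>Words acting on a set\<close>

lemma foldr_closed:
  assumes "\<And>l v. l \<in> L \<Longrightarrow> v \<in> M \<Longrightarrow> \<alpha> l v \<in> M" "set w \<subseteq> L" "v \<in> M"
  shows "foldr \<alpha> w v \<in> M"
  using assms(2,3) by (induction w) (auto intro: assms(1))

lemma foldr_hom:
  assumes "\<And>l. l \<in> L \<Longrightarrow> \<sigma> l \<in> hom G G" "set w \<subseteq> L"
  shows "foldr \<sigma> w \<in> hom G G"
  using assms(2)
proof (induction w)
  case Nil
  then show ?case by (simp add: hom_def)
next
  case (Cons l w)
  then have "foldr \<sigma> w \<in> hom G G" "\<sigma> l \<in> hom G G"
    using assms(1) by auto
  then show ?case
    unfolding foldr_Cons by (rule Group.hom_compose)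
qed

text \<open>
  An action of \<open>free_group X\<close> on the quotient of \<open>M\<close> by the kernel of
  \<open>q\<close>, described by representatives: equations are only required after applying
  \<open>q\<close>. This avoids choosing representatives of cosets when the maps \<open>\<alpha>
  l\<close> are given on words.
\<close>

locale letter_action =
  fixes X :: "'x set" and M :: "'c set" and \<alpha> :: "'x letter \<Rightarrow> 'c \<Rightarrow> 'c" and q :: "'c \<Rightarrow> 'd"
  assumes closed: "\<And>l v. l \<in> X \<times> UNIV \<Longrightarrow> v \<in> M \<Longrightarrow> \<alpha> l v \<in> M"
    and cong: "\<And>l u v. l \<in> X \<times> UNIV \<Longrightarrow> u \<in> M \<Longrightarrow> v \<in> M \<Longrightarrow> q u = q v \<Longrightarrow> q (\<alpha> l u) = q (\<alpha> l v)"
    and cancel: "\<And>l v. l \<in> X \<times> UNIV \<Longrightarrow> v \<in> M \<Longrightarrow> q (\<alpha> l (\<alpha> (inv_letter l) v)) = q v"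
begin

lemma word_closed: "set w \<subseteq> X \<times> UNIV \<Longrightarrow> v \<in> M \<Longrightarrow> foldr \<alpha> w v \<in> M"
  using foldr_closed[of "X \<times> UNIV" M \<alpha>] closed by blast

lemma word_cong:
  assumes "set w \<subseteq> X \<times> UNIV" "u \<in> M" "v \<in> M" "q u = q v"
  shows "q (foldr \<alpha> w u) = q (foldr \<alpha> w v)"
  using assms by (induction w) (auto intro!: cong word_closed)

text \<open>Free reduction does not change the action of a word, because inverse letters cancel.\<close>

lemma act_prepend:
  assumes "l \<in> X \<times> UNIV" "set u \<subseteq> X \<times> UNIV" "v \<in> M"
  shows "q (foldr \<alpha> (prepend l u) v) = q (\<alpha> l (foldr \<alpha> u v))"
proof (cases "\<exists>u'. u = inv_letter l # u'")
  case True
  then obtain u' where u: "u = inv_letter l # u'" by blast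
  then have "foldr \<alpha> u' v \<in> M"
    using assms by (auto intro: word_closed)
  then show ?thesis
    using u assms(1) by (simp add: cancel)
next
  case False
  then have "prepend l u = l # u" by (cases u) auto
  then show ?thesis by simp
qed

lemma act_mult:
  assumes "u \<in> carrier (free_group X)" and u': "u' \<in> carrier (free_group X)" and v: "v \<in> M"
  shows "q (foldr \<alpha> (u \<otimes>\<^bsub>free_group X\<^esub> u') v) = q (foldr \<alpha> u (foldr \<alpha> u' v))"
  using assms(1)
proof (induction u)
  case Nil
  then show ?case by (simp add: free_group_def)
next
  case (Cons l u)
  note l = free_group_ConsD[OF Cons.prems]
  interpret F: group "free_group X" by (rule group_free_group)
  have uu': "u \<otimes>\<^bsub>free_group X\<^esub> u' \<in> carrier (free_group X)"
    using l u' by simp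
  have "(l # u) \<otimes>\<^bsub>free_group X\<^esub> u' = prepend l (u \<otimes>\<^bsub>free_group X\<^esub> u')"
    by (simp add: free_group_def)
  then have "q (foldr \<alpha> ((l # u) \<otimes>\<^bsub>free_group X\<^esub> u') v)
           = q (\<alpha> l (foldr \<alpha> (u \<otimes>\<^bsub>free_group X\<^esub> u') v))"
    using act_prepend[OF l(1) free_group_letters[OF uu'] v] by simp
  also have "\<dots> = q (\<alpha> l (foldr \<alpha> u (foldr \<alpha> u' v)))"
    using Cons.IH[OF l(2)] l uu' u' v by (intro cong) (auto intro!: word_closed free_group_letters)
  finally show ?case by simp
qed

text \<open>The words acting trivially form the kernel of an action, which is a normal subgroup.\<close>

lemma normal_closure_acts_trivially:
  assumes R: "R \<subseteq> carrier (free_group X)"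
    and trivial: "\<And>r v. r \<in> R \<Longrightarrow> v \<in> M \<Longrightarrow> q (foldr \<alpha> r v) = q v"
    and w: "w \<in> normal_closure (free_group X) R" and v: "v \<in> M"
  shows "q (foldr \<alpha> w v) = q v"
proof -
  interpret F: group "free_group X" by (rule group_free_group)
  define N where "N = {u \<in> carrier (free_group X). \<forall>v\<in>M. q (foldr \<alpha> u v) = q v}"
  have inv_act: "q (foldr \<alpha> (inv\<^bsub>free_group X\<^esub> u) (foldr \<alpha> u v)) = q v"
    "q (foldr \<alpha> u (foldr \<alpha> (inv\<^bsub>free_group X\<^esub> u) v)) = q v"
    if "u \<in> carrier (free_group X)" "v \<in> M" for u v
    using that act_mult[of "inv\<^bsub>free_group X\<^esub> u" u v] act_mult[of u "inv\<^bsub>free_group X\<^esub> u" v]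
    by (simp_all add: free_group_one)
  have "N \<lhd> free_group X"
    unfolding F.normal_inv_iff
  proof (intro conjI ballI)
    show "subgroup N (free_group X)"
    proof (rule F.subgroupI)
      show "N \<noteq> {}"
        by (auto simp: N_def intro!: exI[of _ "[]"])
    next
      fix u assume u: "u \<in> N"
      have "q (foldr \<alpha> (inv\<^bsub>free_group X\<^esub> u) v) = q v" if v: "v \<in> M" for v
      proof -
        have "q (foldr \<alpha> (inv\<^bsub>free_group X\<^esub> u) v)
            = q (foldr \<alpha> (inv\<^bsub>free_group X\<^esub> u) (foldr \<alpha> u v))"
          using u v by (intro word_cong free_group_letters) (auto simp: N_def word_closed free_group_letters)
        then show ?thesis
          using inv_act u v by (simp add: N_def)
      qed
      then show "inv\<^bsub>free_group X\<^esub> u \<in> N"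
        using u by (simp add: N_def)
    next
      fix u u' assume "u \<in> N" "u' \<in> N"
      then show "u \<otimes>\<^bsub>free_group X\<^esub> u' \<in> N"
        by (simp add: N_def act_mult word_closed free_group_letters)
    qed (auto simp: N_def)
  next
    fix u n assume u: "u \<in> carrier (free_group X)" and n: "n \<in> N"
    have "q (foldr \<alpha> (u \<otimes>\<^bsub>free_group X\<^esub> n \<otimes>\<^bsub>free_group X\<^esub> inv\<^bsub>free_group X\<^esub> u) v) = q v"
      if v: "v \<in> M" for v
    proof -
      let ?v = "foldr \<alpha> (inv\<^bsub>free_group X\<^esub> u) v"
      have v': "?v \<in> M"
        using u v by (simp add: word_closed free_group_letters)
      have "q (foldr \<alpha> (u \<otimes>\<^bsub>free_group X\<^esub> n \<otimes>\<^bsub>free_group X\<^esub> inv\<^bsub>free_group X\<^esub> u) v)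
          = q (foldr \<alpha> u (foldr \<alpha> n ?v))"
        using u n v v' by (simp add: act_mult N_def)
      also have "\<dots> = q (foldr \<alpha> u ?v)"
        using u n v' by (intro word_cong free_group_letters) (auto simp: N_def word_closed free_group_letters)
      finally show ?thesis
        using inv_act u v by simp
    qed
    then show "u \<otimes>\<^bsub>free_group X\<^esub> n \<otimes>\<^bsub>free_group X\<^esub> inv\<^bsub>free_group X\<^esub> u \<in> N"
      using u n by (simp add: N_def)
  qed
  moreover have "R \<subseteq> N"
    using R trivial by (auto simp: N_def)
  ultimately have "normal_closure (free_group X) R \<subseteq> N"
    unfolding normal_closure_def by blast
  then show ?thesis
    using w v by (auto simp: N_def)
qed

end

section \<open>L-presentations without fixed relations\<close>

text \<open>
  The generators \<open>\<sigma> r\<close> of the kernel are mapped among themselves by a further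
  substitution, since \<open>\<phi> \<circ> \<sigma>\<close> is again a product of substitutions.
  Hence the preimage of the kernel under \<open>\<phi>\<close> is a normal subgroup that contains
  all of them. Fixed relations would spoil this argument.
\<close>

lemma
  assumes P: "l_presentation P" and no_fixed: "fixed_rels P = {}"
  shows l_kernel_iterated_rels: "iterated_rels P \<subseteq> l_kernel P"
    and l_kernel_substs: "\<phi> \<in> substs P \<Longrightarrow> \<phi> ` l_kernel P \<subseteq> l_kernel P"
proof -
  let ?F = "free_group (gens P)"
  let ?A = "\<Union>\<sigma>\<in>generated_monoid (substs P). \<sigma> ` iterated_rels P"
  interpret F: group ?F by (rule group_free_group)
  have K: "l_kernel P = normal_closure ?F ?A"
    by (simp add: l_kernel_def no_fixed)
  have A: "?A \<subseteq> l_kernel P"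
    unfolding K normal_closure_def by blast
  then show "iterated_rels P \<subseteq> l_kernel P"
    using UN_I[OF generated_monoid.one[of "substs P"], of _ "\<lambda>\<sigma>. \<sigma> ` iterated_rels P"] by auto
  have carr: "l_kernel P \<subseteq> carrier ?F"
    by (rule subgroup.subset[OF normal_imp_subgroup[OF l_kernel_normal[OF P]]])
  assume \<phi>: "\<phi> \<in> substs P"
  then have "\<phi> \<in> hom ?F ?F"
    using P by (auto simp: l_presentation_def Let_def)
  then have N: "{x \<in> carrier ?F. \<phi> x \<in> l_kernel P} \<lhd> ?F"
    using l_kernel_normal[OF P] by (rule F.normal_vimage)
  have "?A \<subseteq> {x \<in> carrier ?F. \<phi> x \<in> l_kernel P}"
  proof
    fix a assume a: "a \<in> ?A"
    then obtain \<sigma> r where \<sigma>: "\<sigma> \<in> generated_monoid (substs P)"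
      and r: "r \<in> iterated_rels P" and "a = \<sigma> r"
      by blast
    then have "\<phi> a = (\<phi> \<circ> \<sigma>) r" by simp
    moreover have "\<phi> \<circ> \<sigma> \<in> generated_monoid (substs P)"
      using \<sigma> generated_monoid.incl[OF \<phi>] by (rule generated_monoid.mult)
    ultimately have "\<phi> a \<in> ?A"
      using r by blast
    then show "a \<in> {x \<in> carrier ?F. \<phi> x \<in> l_kernel P}"
      using A a carr by blast
  qed
  then have "l_kernel P \<subseteq> {x \<in> carrier ?F. \<phi> x \<in> l_kernel P}"
    using N unfolding K normal_closure_def by blast
  then show "\<phi> ` l_kernel P \<subseteq> l_kernel P" by blast
qed

lemma l_kernel_least:
  assumes "fixed_rels P = {}" "N \<lhd> free_group (gens P)"
    and rels: "iterated_rels P \<subseteq> N"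
    and substs: "\<And>\<phi>. \<phi> \<in> substs P \<Longrightarrow> \<phi> ` N \<subseteq> N"
  shows "l_kernel P \<subseteq> N"
proof -
  have "\<sigma> ` N \<subseteq> N" if "\<sigma> \<in> generated_monoid (substs P)" for \<sigma>
    using that
  proof induction
    case (mult \<sigma> \<tau>)
    have "\<tau> ` \<sigma> ` N \<subseteq> N"
      using image_mono[OF mult.IH(1)] mult.IH(2) by (rule order_trans)
    then show ?case by (simp only: image_comp)
  next
    case (incl \<phi>)
    then show ?case by (rule substs)
  qed simp
  then have "(\<Union>\<sigma>\<in>generated_monoid (substs P). \<sigma> ` iterated_rels P) \<subseteq> N"
    using rels by blast
  then show ?thesis
    using assms(2) unfolding l_kernel_def normal_closure_def assms(1) by (intro Inter_lower) simp
qed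

section \<open>Lifting an affine action to a free group\<close>

text \<open>
  The data of the introduction. The subgroup \<open>H\<close> is represented by the image of
  \<open>\<pi>\<close>, and \<open>\<tau>\<close> enters only as an endomorphism that is trivial
  there. The words \<open>lift l\<close> express the generators of \<open>H\<close> in those of
  \<open>G\<close>. They are chosen for letters, not just for generators, so that a word over
  \<open>Z\<close> can be rewritten letter by letter.
\<close>

locale affine_lift = group G for G :: "('g, 'b) monoid_scheme" (structure) +
  fixes X :: "'x set" and R :: "'x word set" and p :: "'x word \<Rightarrow> 'g"
    and Z :: "'z set" and \<pi> :: "'z word \<Rightarrow> 'g" and \<tau> :: "'g \<Rightarrow> 'g"
    and \<sigma> :: "'x letter \<Rightarrow> 'z word \<Rightarrow> 'z word" and a :: "'x letter \<Rightarrow> 'z word"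
    and lift :: "'z letter \<Rightarrow> 'x word"
  assumes p_hom: "p \<in> hom (free_group X) G"
    and p_kernel: "kernel (free_group X) G p = normal_closure (free_group X) R"
    and R_words: "R \<subseteq> carrier (free_group X)"
    and \<pi>_hom: "\<pi> \<in> hom (free_group Z) G"
    and \<tau>_hom: "\<tau> \<in> hom G G"
    and \<tau>_\<pi>: "\<And>v. v \<in> carrier (free_group Z) \<Longrightarrow> \<tau> (\<pi> v) = \<one>"
    and \<sigma>_hom: "\<And>l. l \<in> X \<times> UNIV \<Longrightarrow> \<sigma> l \<in> hom (free_group Z) (free_group Z)"
    and \<pi>_\<sigma>: "\<And>l v. l \<in> X \<times> UNIV \<Longrightarrow> v \<in> carrier (free_group Z) \<Longrightarrow>
                 \<pi> (\<sigma> l v) = \<tau> (p [l]) \<otimes> \<pi> v \<otimes> inv \<tau> (p [l])"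
    and a_word: "\<And>l. l \<in> X \<times> UNIV \<Longrightarrow> a l \<in> carrier (free_group Z)"
    and \<pi>_a: "\<And>l. l \<in> X \<times> UNIV \<Longrightarrow> \<pi> (a l) = p [l] \<otimes> inv \<tau> (p [l])"
    and lift_word: "\<And>l. l \<in> Z \<times> UNIV \<Longrightarrow> lift l \<in> carrier (free_group X)"
    and p_lift: "\<And>l. l \<in> Z \<times> UNIV \<Longrightarrow> p (lift l) = \<pi> [l]"
begin

abbreviation F where "F \<equiv> free_group Z"

definition affine :: "'x letter \<Rightarrow> 'z word \<Rightarrow> 'z word" where
  "affine l v = a l \<otimes>\<^bsub>F\<^esub> \<sigma> l v"

text \<open>
  Pairs \<open>(w, u)\<close> for which the lift of \<open>w\<close> shall act as left translation
  by \<open>u\<close> modulo the relators. The first family makes the maps of inverse letters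
  inverse to each other; its words are not reduced.
\<close>

definition translation_pairs :: "('x word \<times> 'z word) set" where
  "translation_pairs = (\<lambda>l. ([l, inv_letter l], [])) ` (X \<times> UNIV) \<union> (\<lambda>r. (r, [])) ` R
     \<union> (\<lambda>l. (lift l, [l])) ` (Z \<times> UNIV)"

definition relators :: "'z word set" where
  "relators = (\<Union>(w, u)\<in>translation_pairs. insert (foldr affine w [] \<otimes>\<^bsub>F\<^esub> inv\<^bsub>F\<^esub> u)
     ((\<lambda>z. foldr \<sigma> w [(z, True)] \<otimes>\<^bsub>F\<^esub> inv\<^bsub>F\<^esub> [(z, True)]) ` Z))"

definition presentation :: "'z l_presentation" where
  "presentation = \<lparr>gens = Z, fixed_rels = {}, substs = \<sigma> ` (X \<times> UNIV), iterated_rels = relators\<rparr>"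

lemma presentation_simps [simp]:
  "gens presentation = Z" "fixed_rels presentation = {}"
  "substs presentation = \<sigma> ` (X \<times> UNIV)" "iterated_rels presentation = relators"
  by (simp_all add: presentation_def)

sublocale F: group F by (rule group_free_group)
sublocale p: group_hom "free_group X" G p
  using p_hom group_free_group by (simp add: group_hom_def group_hom_axioms_def)
sublocale \<pi>: group_hom F G \<pi>
  using \<pi>_hom by unfold_locales
sublocale \<tau>: group_hom G G \<tau>
  using \<tau>_hom by unfold_locales

lemmas hom_Nil [simp] =
  hom_free_group_Nil[OF is_group p_hom] hom_free_group_Nil[OF is_group \<pi>_hom]

lemma \<sigma>_word: "l \<in> X \<times> UNIV \<Longrightarrow> v \<in> carrier F \<Longrightarrow> \<sigma> l v \<in> carrier F"
  using \<sigma>_hom by (auto simp: hom_def)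

lemma affine_word: "l \<in> X \<times> UNIV \<Longrightarrow> v \<in> carrier F \<Longrightarrow> affine l v \<in> carrier F"
  by (simp add: affine_def a_word \<sigma>_word)

lemma \<sigma>s_word: "set w \<subseteq> X \<times> UNIV \<Longrightarrow> v \<in> carrier F \<Longrightarrow> foldr \<sigma> w v \<in> carrier F"
  by (rule foldr_closed[of "X \<times> UNIV"]) (auto intro: \<sigma>_word)

lemma affines_word: "set w \<subseteq> X \<times> UNIV \<Longrightarrow> v \<in> carrier F \<Longrightarrow> foldr affine w v \<in> carrier F"
  by (rule foldr_closed[of "X \<times> UNIV"]) (auto intro: affine_word)

lemma \<sigma>s_hom: "set w \<subseteq> X \<times> UNIV \<Longrightarrow> foldr \<sigma> w \<in> hom F F"
  by (rule foldr_hom[of "X \<times> UNIV"]) (auto intro: \<sigma>_hom)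

lemma affines_eq:
  assumes "set w \<subseteq> X \<times> UNIV" "v \<in> carrier F"
  shows "foldr affine w v = foldr affine w [] \<otimes>\<^bsub>F\<^esub> foldr \<sigma> w v"
  using assms(1)
proof (induction w)
  case Nil
  then show ?case using assms(2) by simp
next
  case (Cons l w)
  then have l: "l \<in> X \<times> UNIV" and w: "set w \<subseteq> X \<times> UNIV" by auto
  interpret \<sigma>: group_hom F F "\<sigma> l"
    using \<sigma>_hom[OF l] by unfold_locales
  have "foldr affine w [] \<in> carrier F" "foldr \<sigma> w v \<in> carrier F"
    using w assms(2) by (simp_all add: affines_word \<sigma>s_word)
  then show ?case
    using Cons.IH[OF w] a_word[OF l]
    by (simp add: affine_def[of l "foldr affine w []"] F.m_assoc
        affine_def[of l "foldr affine w [] \<otimes>\<^bsub>F\<^esub> foldr \<sigma> w v"])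
qed

text \<open>
  The next lemmas evaluate \<open>p\<close> on words that need not be reduced, such as those made of
  a letter and its inverse.
\<close>

abbreviation nf :: "'x word \<Rightarrow> 'x word" where "nf w \<equiv> foldr prepend w []"

lemma nf_word: "set w \<subseteq> X \<times> UNIV \<Longrightarrow> nf w \<in> carrier (free_group X)"
  using set_foldr_prepend[of w "[]"] by (auto simp: free_group_def reduced_foldr)

lemma p_nf_Cons:
  assumes "l \<in> X \<times> UNIV" "set w \<subseteq> X \<times> UNIV"
  shows "p (nf (l # w)) = p [l] \<otimes> p (nf w)"
proof -
  have "nf (l # w) = [l] \<otimes>\<^bsub>free_group X\<^esub> nf w"
    by (simp add: free_group_def)
  then show ?thesis
    using assms by (simp add: free_group_letter nf_word)
qed

lemma p_letter: "l \<in> X \<times> UNIV \<Longrightarrow> p [l] \<in> carrier G"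
  by (simp add: free_group_letter)

text \<open>
  Under \<open>\<pi>\<close>, the lifted maps of a word become conjugation by \<open>\<tau>
  g\<close> and the affine action of \<open>g\<close>, where \<open>g\<close> is the image of the
  word in \<open>G\<close>.
\<close>

lemma \<pi>_\<sigma>s:
  assumes "set w \<subseteq> X \<times> UNIV" "v \<in> carrier F"
  shows "\<pi> (foldr \<sigma> w v) = \<tau> (p (nf w)) \<otimes> \<pi> v \<otimes> inv \<tau> (p (nf w))"
  using assms(1)
proof (induction w)
  case Nil
  then show ?case using assms(2) by simp
next
  case (Cons l w)
  then have l: "l \<in> X \<times> UNIV" and w: "set w \<subseteq> X \<times> UNIV" by auto
  have "foldr \<sigma> w v \<in> carrier F"
    using \<sigma>s_word w assms(2) by blast
  then show ?case
    using Cons.IH[OF w] p_letter[OF l] nf_word[OF w] assms(2)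
    unfolding p_nf_Cons[OF l w] by (simp add: \<pi>_\<sigma>[OF l] m_assoc inv_mult_group)
qed

lemma \<pi>_affines:
  assumes "set w \<subseteq> X \<times> UNIV"
  shows "\<pi> (foldr affine w []) = p (nf w) \<otimes> inv \<tau> (p (nf w))"
  using assms
proof (induction w)
  case Nil
  then show ?case by simp
next
  case (Cons l w)
  then have l: "l \<in> X \<times> UNIV" and w: "set w \<subseteq> X \<times> UNIV" by auto
  have "foldr affine w [] \<in> carrier F"
    using w by (simp add: affines_word)
  moreover have "inv \<tau> (p [l]) \<otimes> (\<tau> (p [l]) \<otimes> g) = g" if "g \<in> carrier G" for g
    using that p_letter[OF l] by (simp flip: m_assoc)
  ultimately show ?case
    using Cons.IH[OF w] p_letter[OF l] nf_word[OF w] \<sigma>_word[OF l] a_word[OF l]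
    unfolding p_nf_Cons[OF l w]
    by (simp add: affine_def[of l "foldr affine w []"] \<pi>_\<sigma>[OF l] \<pi>_a[OF l] m_assoc inv_mult_group)
qed

lemma translation_pairs_words:
  assumes "(w, u) \<in> translation_pairs"
  shows "set w \<subseteq> X \<times> UNIV" "u \<in> carrier F" "p (nf w) = \<pi> u"
proof -
  have lift_pair: "set (lift l) \<subseteq> X \<times> UNIV" "p (nf (lift l)) = \<pi> [l]" if "l \<in> Z \<times> UNIV" for l
    using lift_word[OF that] p_lift[OF that]
    by (auto simp: free_group_def foldr_prepend_Nil)
  have R: "set r \<subseteq> X \<times> UNIV" "p (nf r) = \<one>" if "r \<in> R" for r
  proof -
    have r: "r \<in> carrier (free_group X)" "reduced r"
      using that R_words by (auto simp: free_group_def)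
    then show "set r \<subseteq> X \<times> UNIV" by (simp add: free_group_letters)
    have "r \<in> normal_closure (free_group X) R"
      using that by (auto simp: normal_closure_def)
    then show "p (nf r) = \<one>"
      using r unfolding p_kernel[symmetric] by (simp add: foldr_prepend_Nil kernel_def)
  qed
  show "set w \<subseteq> X \<times> UNIV"
    using assms lift_pair(1) R(1) unfolding translation_pairs_def by (force simp: inv_letter_def)
  show "u \<in> carrier F"
    using assms by (auto simp: translation_pairs_def free_group_letter)
  show "p (nf w) = \<pi> u"
    using assms lift_pair(2) R(2) by (auto simp: translation_pairs_def)
qed

text \<open>
  If \<open>(w, u)\<close> is one of the pairs, the image of \<open>w\<close> in \<open>G\<close>
  equals \<open>\<pi> u\<close>, where \<open>\<tau>\<close> is trivial. So the affine action of
  \<open>w\<close> on the image of \<open>\<pi>\<close> really is left translation by \<open>\<pi>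
  u\<close>.
\<close>

lemma relators_kernel: "relators \<subseteq> kernel F G \<pi>"
proof -
  have "foldr affine w [] \<otimes>\<^bsub>F\<^esub> inv\<^bsub>F\<^esub> u \<in> kernel F G \<pi>"
    and "z \<in> Z \<Longrightarrow> foldr \<sigma> w [(z, True)] \<otimes>\<^bsub>F\<^esub> inv\<^bsub>F\<^esub> [(z, True)] \<in> kernel F G \<pi>"
    if wu: "(w, u) \<in> translation_pairs" for w u z
  proof -
    note t = translation_pairs_words[OF wu]
    have \<tau>w: "\<tau> (p (nf w)) = \<one>"
      using t \<tau>_\<pi> by simp
    have "foldr affine w [] \<in> carrier F"
      using t by (simp add: affines_word)
    then show "foldr affine w [] \<otimes>\<^bsub>F\<^esub> inv\<^bsub>F\<^esub> u \<in> kernel F G \<pi>"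
      using t \<tau>w by (simp add: kernel_def \<pi>_affines)
    assume "z \<in> Z"
    then have z: "[(z, True)] \<in> carrier F"
      by (rule free_group_gen)
    then have "foldr \<sigma> w [(z, True)] \<in> carrier F"
      using \<sigma>s_word t by blast
    then show "foldr \<sigma> w [(z, True)] \<otimes>\<^bsub>F\<^esub> inv\<^bsub>F\<^esub> [(z, True)] \<in> kernel F G \<pi>"
      using t z \<tau>w by (simp add: kernel_def \<pi>_\<sigma>s)
  qed
  then show ?thesis
    unfolding relators_def by auto
qed

lemma l_presentation: "l_presentation presentation"
  using relators_kernel \<sigma>_hom by (auto simp: l_presentation_def Let_def kernel_def)

lemma l_kernel_subset: "l_kernel presentation \<subseteq> kernel F G \<pi>"
proof (rule l_kernel_least)
  show "kernel F G \<pi> \<lhd> free_group (gens presentation)"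
    by (simp add: \<pi>.normal_kernel)
  show "\<phi> ` kernel F G \<pi> \<subseteq> kernel F G \<pi>" if "\<phi> \<in> substs presentation" for \<phi>
    using that by (auto simp: kernel_def \<sigma>_word \<pi>_\<sigma> free_group_letter)
  show "fixed_rels presentation = {}" by simp
  show "iterated_rels presentation \<subseteq> kernel F G \<pi>" using relators_kernel by simp
qed

text \<open>
  Let \<open>F(X)\<close> act on \<open>F/K\<close> through the lifted affine maps. A word over
  \<open>Z\<close> can be rewritten as a word over \<open>X\<close> with the same image in
  \<open>G\<close> that moves the trivial coset to the coset of the given word. If that image is
  trivial, the rewritten word lies in the normal closure of \<open>R\<close> and fixes the trivial
  coset.
\<close>

lemma kernel_subset: "kernel F G \<pi> \<subseteq> l_kernel presentation"
proof
  define K where "K = l_kernel presentation"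
  define q where "q v = K #>\<^bsub>F\<^esub> v" for v
  interpret K: normal K F
    using l_kernel_normal[OF l_presentation] by (simp add: K_def)
  interpret Q: group "F Mod K"
    by (rule K.factorgroup_is_group)
  have q_hom: "q \<in> hom F (F Mod K)"
    unfolding q_def by (rule K.r_coset_hom_Mod)
  interpret q: group_hom F "F Mod K" q
    using q_hom by unfold_locales
  have cong: "q (affine l u) = q (affine l v)"
    if l: "l \<in> X \<times> UNIV" and "u \<in> carrier F" "v \<in> carrier F" "q u = q v" for l u v
  proof -
    have "\<sigma> l ` K \<subseteq> K"
      unfolding K_def using l l_kernel_substs[OF l_presentation] by simp
    then have "q (\<sigma> l u) = q (\<sigma> l v)"
      using that(2-4) unfolding q_def by (rule K.hom_preserves_rcos_eq[OF \<sigma>_hom[OF l]])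
    then show ?thesis
      using that by (simp add: affine_def a_word \<sigma>_word)
  qed
  have translate: "q (foldr affine w v) = q (u \<otimes>\<^bsub>F\<^esub> v)"
    if wu: "(w, u) \<in> translation_pairs" and v: "v \<in> carrier F" for w u v
  proof -
    note t = translation_pairs_words[OF wu]
    have rel: "relators \<subseteq> K"
      using l_kernel_iterated_rels[OF l_presentation] by (simp add: K_def)
    have w1: "foldr affine w [] \<in> carrier F"
      using t by (simp add: affines_word)
    have "foldr affine w [] \<otimes>\<^bsub>F\<^esub> inv\<^bsub>F\<^esub> u \<in> K"
      using wu rel unfolding relators_def by blast
    then have 1: "q (foldr affine w []) = q u"
      unfolding q_def using w1 t(2) by (intro K.rcos_eqI)
    have \<sigma>w: "foldr \<sigma> w \<in> hom F F"
      using \<sigma>s_hom t(1) by blast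
    \<comment> \<open>The relators force this on generators only; both sides are homomorphisms.\<close>
    have "(q \<circ> foldr \<sigma> w) v = q v"
    proof (rule free_group_hom_eqI[OF Q.is_group _ q_hom _ v])
      show "q \<circ> foldr \<sigma> w \<in> hom F (F Mod K)"
        by (rule Group.hom_compose[OF \<sigma>w q_hom])
      fix z assume z: "z \<in> Z"
      then have "foldr \<sigma> w [(z, True)] \<otimes>\<^bsub>F\<^esub> inv\<^bsub>F\<^esub> [(z, True)] \<in> K"
        using wu rel unfolding relators_def by blast
      then show "(q \<circ> foldr \<sigma> w) [(z, True)] = q [(z, True)]"
        unfolding q_def o_def using z t(1) free_group_gen[OF z, of True]
        by (intro K.rcos_eqI) (auto intro: \<sigma>s_word)
    qed
    then show ?thesis
      using 1 w1 t v \<sigma>s_word[OF t(1) v] by (simp add: affines_eq[OF t(1) v])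
  qed
  have w_lift: "(lift l, [l]) \<in> translation_pairs" if "l \<in> Z \<times> UNIV" for l
    using that by (auto simp: translation_pairs_def)
  interpret letter_action X "carrier F" affine q
  proof
    fix l :: "'x letter" and u v
    assume l: "l \<in> X \<times> UNIV" and v: "v \<in> carrier F"
    show "affine l v \<in> carrier F"
      using l v by (rule affine_word)
    show "q (affine l u) = q (affine l v)" if "u \<in> carrier F" "q u = q v"
      using l that(1) v that(2) by (rule cong)
    have "([l, inv_letter l], []) \<in> translation_pairs"
      using l by (simp add: translation_pairs_def)
    from translate[OF this v] show "q (affine l (affine (inv_letter l) v)) = q v"
      by simp
  qed
  have lift_words: "\<exists>w\<in>carrier (free_group X). p w = \<pi> v \<and> q (foldr affine w []) = q v"
    if "v \<in> carrier F" for v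
    using that
  proof (induction v)
    case Nil
    show ?case
      by (rule bexI[of _ "[]"]) simp_all
  next
    case (Cons l v)
    note l = free_group_ConsD[OF Cons.prems]
    obtain w where w: "w \<in> carrier (free_group X)" "p w = \<pi> v" "q (foldr affine w []) = q v"
      using Cons.IH l(2) by blast
    have w1: "foldr affine w [] \<in> carrier F"
      using w(1) by (intro word_closed free_group_letters) simp_all
    have "q (foldr affine (lift l \<otimes>\<^bsub>free_group X\<^esub> w) []) = q (foldr affine (lift l) (foldr affine w []))"
      using lift_word[OF l(1)] w(1) by (intro act_mult) simp_all
    also have "\<dots> = q ([l] \<otimes>\<^bsub>F\<^esub> foldr affine w [])"
      using translate[OF w_lift[OF l(1)] w1] .
    also have "\<dots> = q (l # v)"
      using w w1 l free_group_letter[OF l(1)] by simp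
    finally show ?case
      using lift_word[OF l(1)] p_lift[OF l(1)] w l free_group_letter[OF l(1)]
      by (intro bexI[of _ "lift l \<otimes>\<^bsub>free_group X\<^esub> w"]) simp_all
  qed
  fix v assume v: "v \<in> kernel F G \<pi>"
  then have v': "v \<in> carrier F" "\<pi> v = \<one>"
    by (simp_all add: kernel_def)
  then obtain w where w: "w \<in> carrier (free_group X)" "p w = \<one>" "q (foldr affine w []) = q v"
    using lift_words[OF v'(1)] unfolding v'(2) by blast
  have "w \<in> normal_closure (free_group X) R"
    using w unfolding p_kernel[symmetric] by (simp add: kernel_def)
  moreover have "q (foldr affine r u) = q u" if "r \<in> R" "u \<in> carrier F" for r u
    using translate[of r "[]" u] that by (auto simp: translation_pairs_def)
  ultimately have "q (foldr affine w []) = q []"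
    using normal_closure_acts_trivially[OF R_words] by simp
  then have "K #>\<^bsub>F\<^esub> v = K"
    using w(3) hom_free_group_Nil[OF Q.is_group q_hom] by (simp add: q_def)
  then show "v \<in> l_kernel presentation"
    using F.coset_join1[OF _ v'(1) K.is_subgroup] unfolding K_def by blast
qed

lemma l_kernel_eq: "l_kernel presentation = kernel F G \<pi>"
  using l_kernel_subset kernel_subset by blast

lemma invariant: "invariant_l_presentation presentation"
  using l_presentation l_kernel_substs[OF l_presentation]
  by (simp add: invariant_l_presentation_def)

lemma finite_l_presentation:
  assumes "finite X" "finite R" "finite Z"
  shows "finite_l_presentation presentation"
proof -
  have "finite translation_pairs"
    using assms by (simp add: translation_pairs_def)
  then have "finite relators"
    using assms by (auto simp: relators_def)
  then show ?thesis
    using assms l_presentation by (simp add: finite_l_presentation_def)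
qed

lemma l_group_iso:
  assumes "subgroup H G" "\<pi> ` carrier F = H"
  shows "G\<lparr>carrier := H\<rparr> \<cong> l_group presentation"
proof -
  have H: "group (G\<lparr>carrier := H\<rparr>)"
    using assms(1) by (rule subgroup_imp_group)
  interpret \<pi>H: group_hom F "G\<lparr>carrier := H\<rparr>" \<pi>
    using H assms(2) \<pi>_hom group_free_group
    by (auto simp: group_hom_def group_hom_axioms_def hom_def)
  have "kernel F (G\<lparr>carrier := H\<rparr>) \<pi> = l_kernel presentation"
    by (simp add: l_kernel_eq kernel_def)
  then have "l_group presentation \<cong> G\<lparr>carrier := H\<rparr>"
    using \<pi>H.FactGroup_iso assms(2) by (simp add: l_group_def)
  then show ?thesis
    using group.iso_sym[OF group_l_group[OF l_presentation]] by blast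
qed

end

section \<open>Presentations, retractions and lifts as homomorphisms\<close>

lemma finitely_presented_hom:
  assumes "group G" "finitely_presented G"
  obtains X :: "nat set" and R p where "finite X" "finite R" "R \<subseteq> carrier (free_group X)"
    "p \<in> hom (free_group X) G" "p ` carrier (free_group X) = carrier G"
    "kernel (free_group X) G p = normal_closure (free_group X) R"
proof -
  interpret group G by fact
  obtain X :: "nat set" and R where XR: "finite X" "finite R" "R \<subseteq> carrier (free_group X)"
    and iso: "G \<cong> free_group X Mod normal_closure (free_group X) R"
    using assms(2) unfolding finitely_presented_def by blast
  let ?F = "free_group X" and ?N = "normal_closure (free_group X) R"
  interpret F: group ?F by (rule group_free_group)
  interpret N: normal ?N ?F
    using normal_closure_normal[OF group_free_group XR(3)] .
  obtain h where h: "h \<in> iso (?F Mod ?N) G"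
    using iso_sym[OF iso] unfolding is_iso_def by blast
  define p where "p w = h (?N #>\<^bsub>?F\<^esub> w)" for w
  have p: "p \<in> hom ?F G"
    using Group.hom_compose[OF N.r_coset_hom_Mod] h unfolding p_def iso_def o_def by blast
  have onto: "p ` carrier ?F = carrier G"
  proof -
    have "carrier (?F Mod ?N) = (\<lambda>w. ?N #>\<^bsub>?F\<^esub> w) ` carrier ?F"
      by (auto simp: FactGroup_def RCOSETS_def)
    moreover have "h ` carrier (?F Mod ?N) = carrier G"
      using h by (simp add: iso_def bij_betw_def)
    ultimately show ?thesis
      by (simp add: p_def image_image)
  qed
  have "p w = \<one>\<^bsub>G\<^esub> \<longleftrightarrow> w \<in> ?N" if w: "w \<in> carrier ?F" for w
  proof -
    interpret h: group_hom "?F Mod ?N" G h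
      using h N.factorgroup_is_group by (simp add: group_hom_def group_hom_axioms_def iso_def)
    have c: "?N #>\<^bsub>?F\<^esub> w \<in> carrier (?F Mod ?N)" "?N \<in> carrier (?F Mod ?N)"
      using w N.r_coset_hom_Mod h.G.one_closed by (auto simp: hom_def)
    have "h ?N = \<one>\<^bsub>G\<^esub>"
      using h.hom_one by simp
    then have "p w = \<one>\<^bsub>G\<^esub> \<longleftrightarrow> ?N #>\<^bsub>?F\<^esub> w = ?N"
      using h c unfolding p_def iso_def bij_betw_def by (metis (mono_tags, lifting) inj_onD mem_Collect_eq)
    also have "\<dots> \<longleftrightarrow> w \<in> ?N"
      using F.coset_join1 F.coset_join2 w N.is_subgroup by blast
    finally show ?thesis .
  qed
  then have "kernel ?F G p = ?N"
    using N.subset by (auto simp: kernel_def)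
  then show thesis
    using that XR p onto by blast
qed

lemma finitely_generated_hom:
  assumes "group H" "finitely_generated H"
  obtains Z :: "nat set" and \<pi> where "finite Z" "\<pi> \<in> hom (free_group Z) H"
    "\<pi> ` carrier (free_group Z) = carrier H"
proof -
  interpret group H by fact
  obtain A where A: "finite A" "A \<subseteq> carrier H" "generate H A = carrier H"
    using assms(2) unfolding finitely_generated_def by blast
  obtain f :: "nat \<Rightarrow> 'a" where f: "f ` {..<card A} = A"
    using ex_bij_betw_nat_finite[OF A(1)] unfolding bij_betw_def atLeast0LessThan by blast
  let ?Z = "{..<card A}"
  have "f \<in> ?Z \<rightarrow> carrier H"
    using f A(2) by blast
  from free_group_universal[OF assms(1) this] obtain \<pi> where
    \<pi>: "\<pi> \<in> hom (free_group ?Z) H" "\<And>z. z \<in> ?Z \<Longrightarrow> \<pi> [(z, True)] = f z"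
    by blast
  interpret \<pi>: group_hom "free_group ?Z" H \<pi>
    using \<pi>(1) group_free_group by (simp add: group_hom_def group_hom_axioms_def)
  have "A \<subseteq> \<pi> ` carrier (free_group ?Z)"
  proof
    fix x assume "x \<in> A"
    then obtain z where "z \<in> ?Z" "x = f z" using f by blast
    then show "x \<in> \<pi> ` carrier (free_group ?Z)"
      using \<pi>(2) free_group_gen by (metis imageI)
  qed
  then have "generate H A \<subseteq> \<pi> ` carrier (free_group ?Z)"
    using \<pi>.img_is_subgroup by (rule generate_subgroup_incl)
  then have "\<pi> ` carrier (free_group ?Z) = carrier H"
    using A(3) by auto
  then show thesis
    using that[of ?Z \<pi>] \<pi>(1) by blast
qed

text \<open>
  The component of \<open>g\<close> in the complement \<open>S\<close> is the only \<open>s \<in>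
  S\<close> with \<open>g s\<inverse> \<in> H\<close>; uniqueness and normality of \<open>H\<close>
  make it multiplicative.
\<close>

lemma splits_over_retraction:
  assumes "H \<lhd> G" "splits_over G H"
  obtains \<tau> where "\<tau> \<in> hom G G" "\<And>h. h \<in> H \<Longrightarrow> \<tau> h = \<one>\<^bsub>G\<^esub>"
    "\<And>g. g \<in> carrier G \<Longrightarrow> g \<otimes>\<^bsub>G\<^esub> inv\<^bsub>G\<^esub> \<tau> g \<in> H"
proof -
  interpret H: normal H G by fact
  obtain S where S: "subgroup S G" "carrier G = H <#>\<^bsub>G\<^esub> S" "S \<inter> H = {\<one>\<^bsub>G\<^esub>}"
    using assms(2) unfolding splits_over_def by blast
  interpret S: subgroup S G by fact
  have "\<exists>s\<in>S. g \<otimes>\<^bsub>G\<^esub> inv\<^bsub>G\<^esub> s \<in> H" if "g \<in> carrier G" for g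
  proof -
    have "g \<in> H <#>\<^bsub>G\<^esub> S"
      using that by (simp only: S(2))
    then obtain h s where hs: "h \<in> H" "s \<in> S" "g = h \<otimes>\<^bsub>G\<^esub> s"
      unfolding set_mult_def by blast
    then have "g \<otimes>\<^bsub>G\<^esub> inv\<^bsub>G\<^esub> s = h"
      by (simp add: H.m_assoc)
    then show ?thesis using hs(1,2) by (intro bexI[of _ s]) simp_all
  qed
  then obtain \<tau> where \<tau>: "\<And>g. g \<in> carrier G \<Longrightarrow> \<tau> g \<in> S"
    "\<And>g. g \<in> carrier G \<Longrightarrow> g \<otimes>\<^bsub>G\<^esub> inv\<^bsub>G\<^esub> \<tau> g \<in> H"
    by metis
  have unique: "\<tau> g = s" if g: "g \<in> carrier G" and s: "s \<in> S" and gs: "g \<otimes>\<^bsub>G\<^esub> inv\<^bsub>G\<^esub> s \<in> H" for g s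
  proof -
    have "inv\<^bsub>G\<^esub> (g \<otimes>\<^bsub>G\<^esub> inv\<^bsub>G\<^esub> \<tau> g) \<otimes>\<^bsub>G\<^esub> (g \<otimes>\<^bsub>G\<^esub> inv\<^bsub>G\<^esub> s) \<in> H"
      using subgroup.m_closed[OF H.is_subgroup subgroup.m_inv_closed[OF H.is_subgroup \<tau>(2)[OF g]] gs] .
    moreover have "inv\<^bsub>G\<^esub> (g \<otimes>\<^bsub>G\<^esub> inv\<^bsub>G\<^esub> \<tau> g) \<otimes>\<^bsub>G\<^esub> (g \<otimes>\<^bsub>G\<^esub> inv\<^bsub>G\<^esub> s) = \<tau> g \<otimes>\<^bsub>G\<^esub> inv\<^bsub>G\<^esub> s"
    proof -
      have c: "\<tau> g \<in> carrier G" "s \<in> carrier G" using \<tau>(1)[OF g] s by auto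
      then have "inv\<^bsub>G\<^esub> g \<otimes>\<^bsub>G\<^esub> (g \<otimes>\<^bsub>G\<^esub> inv\<^bsub>G\<^esub> s) = inv\<^bsub>G\<^esub> s"
        using g by (simp flip: H.m_assoc)
      then show ?thesis
        using g c by (simp add: H.inv_mult_group H.m_assoc)
    qed
    moreover have "\<tau> g \<otimes>\<^bsub>G\<^esub> inv\<^bsub>G\<^esub> s \<in> S"
      using \<tau>(1)[OF g] s by simp
    ultimately have "\<tau> g \<otimes>\<^bsub>G\<^esub> inv\<^bsub>G\<^esub> s = \<one>\<^bsub>G\<^esub>"
      using S(3) by (metis IntI singletonD)
    then show ?thesis
      using \<tau>(1)[OF g] s H.inv_solve_right'[of "\<one>\<^bsub>G\<^esub>" "\<tau> g" s] by simp
  qed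
  have "\<tau> (g \<otimes>\<^bsub>G\<^esub> g') = \<tau> g \<otimes>\<^bsub>G\<^esub> \<tau> g'" if g: "g \<in> carrier G" and g': "g' \<in> carrier G" for g g'
  proof (rule unique)
    have c: "\<tau> g \<in> carrier G" "\<tau> g' \<in> carrier G"
      using \<tau>(1) g g' by auto
    have "(g \<otimes>\<^bsub>G\<^esub> inv\<^bsub>G\<^esub> \<tau> g) \<otimes>\<^bsub>G\<^esub> (\<tau> g \<otimes>\<^bsub>G\<^esub> (g' \<otimes>\<^bsub>G\<^esub> inv\<^bsub>G\<^esub> \<tau> g') \<otimes>\<^bsub>G\<^esub> inv\<^bsub>G\<^esub> \<tau> g) \<in> H"
      using subgroup.m_closed[OF H.is_subgroup \<tau>(2)[OF g] H.inv_op_closed2[OF c(1) \<tau>(2)[OF g']]] .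
    moreover have "inv\<^bsub>G\<^esub> \<tau> g \<otimes>\<^bsub>G\<^esub> (\<tau> g \<otimes>\<^bsub>G\<^esub> x) = x" if "x \<in> carrier G" for x
      using that c by (simp flip: H.m_assoc)
    ultimately show "g \<otimes>\<^bsub>G\<^esub> g' \<otimes>\<^bsub>G\<^esub> inv\<^bsub>G\<^esub> (\<tau> g \<otimes>\<^bsub>G\<^esub> \<tau> g') \<in> H"
      using g g' c by (simp add: H.m_assoc H.inv_mult_group)
  qed (use g g' \<tau>(1) in simp_all)
  then have "\<tau> \<in> hom G G"
    using \<tau>(1) by (auto simp: hom_def)
  moreover have "\<tau> h = \<one>\<^bsub>G\<^esub>" if "h \<in> H" for h
    using that by (intro unique) simp_all
  ultimately show thesis
    using \<tau>(2) by (rule that)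
qed

text \<open>Freeness allows lifting the conjugates of the generators one by one.\<close>

lemma lift_conjugation:
  assumes "H \<lhd> G" and \<pi>: "\<pi> \<in> hom (free_group Z) G" "\<pi> ` carrier (free_group Z) = H"
    and g: "g \<in> carrier G"
  shows "\<exists>\<sigma> \<in> hom (free_group Z) (free_group Z). \<forall>v \<in> carrier (free_group Z).
           \<pi> (\<sigma> v) = g \<otimes>\<^bsub>G\<^esub> \<pi> v \<otimes>\<^bsub>G\<^esub> inv\<^bsub>G\<^esub> g"
proof -
  interpret H: normal H G by fact
  let ?F = "free_group Z"
  have "\<exists>w \<in> carrier ?F. \<pi> w = g \<otimes>\<^bsub>G\<^esub> \<pi> [(z, True)] \<otimes>\<^bsub>G\<^esub> inv\<^bsub>G\<^esub> g" if "z \<in> Z" for z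
  proof -
    have "\<pi> [(z, True)] \<in> H"
      using free_group_gen[OF that] \<pi>(2) by blast
    then have "g \<otimes>\<^bsub>G\<^esub> \<pi> [(z, True)] \<otimes>\<^bsub>G\<^esub> inv\<^bsub>G\<^esub> g \<in> \<pi> ` carrier ?F"
      using g H.inv_op_closed2 \<pi>(2) by simp
    then show ?thesis by (metis imageE)
  qed
  then obtain f where f: "\<And>z. z \<in> Z \<Longrightarrow> f z \<in> carrier ?F"
    "\<And>z. z \<in> Z \<Longrightarrow> \<pi> (f z) = g \<otimes>\<^bsub>G\<^esub> \<pi> [(z, True)] \<otimes>\<^bsub>G\<^esub> inv\<^bsub>G\<^esub> g"
    by metis
  then have "f \<in> Z \<rightarrow> carrier ?F" by blast
  from free_group_universal[OF group_free_group this] obtain \<sigma> where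
    \<sigma>: "\<sigma> \<in> hom ?F ?F" "\<And>z. z \<in> Z \<Longrightarrow> \<sigma> [(z, True)] = f z"
    by blast
  have conj: "(\<lambda>x. g \<otimes>\<^bsub>G\<^esub> x \<otimes>\<^bsub>G\<^esub> inv\<^bsub>G\<^esub> g) \<in> hom G G"
  proof -
    have "inv\<^bsub>G\<^esub> g \<otimes>\<^bsub>G\<^esub> (g \<otimes>\<^bsub>G\<^esub> x) = x" if "x \<in> carrier G" for x
      using that g by (simp flip: H.m_assoc)
    then show ?thesis
      using g by (auto simp: hom_def H.m_assoc)
  qed
  have "(\<pi> \<circ> \<sigma>) v = ((\<lambda>x. g \<otimes>\<^bsub>G\<^esub> x \<otimes>\<^bsub>G\<^esub> inv\<^bsub>G\<^esub> g) \<circ> \<pi>) v" if "v \<in> carrier ?F" for v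
  proof (rule free_group_hom_eqI[OF H.is_group _ _ _ that])
    show "\<pi> \<circ> \<sigma> \<in> hom ?F G"
      using \<sigma>(1) \<pi>(1) by (rule Group.hom_compose)
    show "(\<lambda>x. g \<otimes>\<^bsub>G\<^esub> x \<otimes>\<^bsub>G\<^esub> inv\<^bsub>G\<^esub> g) \<circ> \<pi> \<in> hom ?F G"
      using \<pi>(1) conj by (rule Group.hom_compose)
  qed (simp add: \<sigma>(2) f(2))
  then show ?thesis
    using \<sigma>(1) by auto
qed

theorem theoremC:
  fixes G :: "('g, 'b) monoid_scheme" and H :: "'g set"
  assumes "group G"
    and "finitely_presented G"
    and "H \<lhd> G"
    and "finitely_generated (G\<lparr>carrier := H\<rparr>)"
    and "splits_over G H"
  shows "invariantly_finitely_L_presented (G\<lparr>carrier := H\<rparr>)"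
proof -
  interpret group G by fact
  interpret H: normal H G by fact
  obtain X :: "nat set" and R p where X: "finite X" "finite R" "R \<subseteq> carrier (free_group X)"
    and p: "p \<in> hom (free_group X) G" "p ` carrier (free_group X) = carrier G"
      "kernel (free_group X) G p = normal_closure (free_group X) R"
    by (rule finitely_presented_hom[OF assms(1,2)])
  obtain Z :: "nat set" and \<pi> where Z: "finite Z" "\<pi> \<in> hom (free_group Z) (G\<lparr>carrier := H\<rparr>)"
    and onto: "\<pi> ` carrier (free_group Z) = H"
    using finitely_generated_hom[OF subgroup_imp_group[OF H.is_subgroup] assms(4)] by auto
  have \<pi>: "\<pi> \<in> hom (free_group Z) G"
    using Z(2) H.subset by (auto simp: hom_def)
  obtain \<tau> where \<tau>: "\<tau> \<in> hom G G" "\<And>h. h \<in> H \<Longrightarrow> \<tau> h = \<one>\<^bsub>G\<^esub>"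
    "\<And>g. g \<in> carrier G \<Longrightarrow> g \<otimes>\<^bsub>G\<^esub> inv\<^bsub>G\<^esub> \<tau> g \<in> H"
    using splits_over_retraction[OF assms(3,5)] by metis
  have pl: "p [l] \<in> carrier G" "\<tau> (p [l]) \<in> carrier G" if "l \<in> X \<times> UNIV" for l
    using free_group_letter[OF that] p(1) \<tau>(1) by (auto simp: hom_def)
  have "\<forall>l\<in>X \<times> UNIV. \<exists>\<sigma> \<in> hom (free_group Z) (free_group Z). \<forall>v \<in> carrier (free_group Z).
           \<pi> (\<sigma> v) = \<tau> (p [l]) \<otimes>\<^bsub>G\<^esub> \<pi> v \<otimes>\<^bsub>G\<^esub> inv\<^bsub>G\<^esub> \<tau> (p [l])"
    using lift_conjugation[OF assms(3) \<pi> onto pl(2)] by (rule ballI)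
  then obtain \<sigma> where \<sigma>: "\<And>l. l \<in> X \<times> UNIV \<Longrightarrow> \<sigma> l \<in> hom (free_group Z) (free_group Z)"
    "\<And>l v. l \<in> X \<times> UNIV \<Longrightarrow> v \<in> carrier (free_group Z) \<Longrightarrow>
       \<pi> (\<sigma> l v) = \<tau> (p [l]) \<otimes>\<^bsub>G\<^esub> \<pi> v \<otimes>\<^bsub>G\<^esub> inv\<^bsub>G\<^esub> \<tau> (p [l])"
    by metis
  have "\<forall>l\<in>X \<times> UNIV. \<exists>v\<in>carrier (free_group Z). \<pi> v = p [l] \<otimes>\<^bsub>G\<^esub> inv\<^bsub>G\<^esub> \<tau> (p [l])"
  proof
    fix l assume "l \<in> X \<times> (UNIV :: bool set)"
    then have "p [l] \<otimes>\<^bsub>G\<^esub> inv\<^bsub>G\<^esub> \<tau> (p [l]) \<in> \<pi> ` carrier (free_group Z)"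
      using \<tau>(3) pl(1) unfolding onto by simp
    then show "\<exists>v\<in>carrier (free_group Z). \<pi> v = p [l] \<otimes>\<^bsub>G\<^esub> inv\<^bsub>G\<^esub> \<tau> (p [l])"
      by (rule imageE) (rule bexI, rule sym)
  qed
  then obtain a where a: "\<And>l. l \<in> X \<times> UNIV \<Longrightarrow> a l \<in> carrier (free_group Z)"
    "\<And>l. l \<in> X \<times> UNIV \<Longrightarrow> \<pi> (a l) = p [l] \<otimes>\<^bsub>G\<^esub> inv\<^bsub>G\<^esub> \<tau> (p [l])"
    by metis
  have "\<forall>l\<in>Z \<times> UNIV. \<exists>w\<in>carrier (free_group X). p w = \<pi> [l]"
  proof
    fix l assume "l \<in> Z \<times> (UNIV :: bool set)"
    then have "\<pi> [l] \<in> p ` carrier (free_group X)"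
      unfolding p(2) by (rule hom_in_carrier[OF \<pi> free_group_letter])
    then show "\<exists>w\<in>carrier (free_group X). p w = \<pi> [l]"
      by (rule imageE) (rule bexI, rule sym)
  qed
  then obtain lift where lift: "\<And>l. l \<in> Z \<times> UNIV \<Longrightarrow> lift l \<in> carrier (free_group X)"
    "\<And>l. l \<in> Z \<times> UNIV \<Longrightarrow> p (lift l) = \<pi> [l]"
    by metis
  interpret affine_lift G X R p Z \<pi> \<tau> \<sigma> a lift
  proof unfold_locales
    show "R \<subseteq> carrier (free_group X)" by (rule X(3))
    show "p \<in> hom (free_group X) G" by (rule p(1))
    show "kernel (free_group X) G p = normal_closure (free_group X) R" by (rule p(3))
    show "\<tau> (\<pi> v) = \<one>\<^bsub>G\<^esub>" if "v \<in> carrier (free_group Z)" for v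
      using that onto by (intro \<tau>(2)) blast
  qed (fact \<pi> \<tau>(1) \<sigma> a lift)+
  show ?thesis
    unfolding invariantly_finitely_L_presented_def
    by (intro exI[of _ presentation] conjI finite_l_presentation invariant l_group_iso
        X(1,2) Z(1) H.is_subgroup onto)
qed

end
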